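(* Let $q$ be a prime power and $a,b,d,d_1,d_2,u$ positive integers with $2d\le d_1+d_2$. Then $\Lambda(q,a,b,d,u)\ge\min\{A_q(a,d_1;u),A_q(b,d_2;u)\}$.
   Context: $\Lambda(q,a,b,d,u)$ is the maximum size of a set of $a\times b$ matrices over $\mathbb{F}_q$ such that any two distinct elements $X,Y$ satisfy $\mathrm{rk}(X-Y)\ge d$ and every element has rank at most $u$. $A_q(v,d;k)$ is the maximum number of $k$-dimensional subspaces of $\mathbb{F}_q^v$ with pairwise subspace distance $\dim(U+W)-\dim(U\cap W)$ at least $d$. *)

theory Defs
  imports "HOL-Analysis.Cartesian_Space"
begin

text \<open>
  The field with \<open>q\<close> elements is a type \<open>'f\<close> of classes \<open>field\<close> and \<open>finite\<close>, where
  \<open>q = CARD('f)\<close>. An \<open>a \<times> b\<close> matrix (\<open>a\<close> rows, \<open>b\<close> columns) has type \<open>'f ^ 'b ^ 'a\<close> with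
  \<open>a = CARD('a)\<close> and \<open>b = CARD('b)\<close>; the ambient space of dimension \<open>v = CARD('v)\<close> is
  \<open>'f ^ 'v\<close>.
\<close>

definition bounded_rank_code :: "nat \<Rightarrow> nat \<Rightarrow> ('f::{field,finite} ^ 'b ^ 'a) set \<Rightarrow> bool" where
  "bounded_rank_code d u C \<longleftrightarrow>
     (\<forall>X\<in>C. \<forall>Y\<in>C. X \<noteq> Y \<longrightarrow> d \<le> rank (X - Y)) \<and> (\<forall>X\<in>C. rank X \<le> u)"

definition Lambda ::
    "'f::{field,finite} itself \<Rightarrow> 'a::finite itself \<Rightarrow> 'b::finite itself \<Rightarrow> nat \<Rightarrow> nat \<Rightarrow> nat" where
  "Lambda _ _ _ d u = Max {card C | C :: ('f ^ 'b ^ 'a) set. bounded_rank_code d u C}"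

text \<open>The subtraction does not truncate, since the intersection is contained in the sum.\<close>

definition subspace_dist :: "('f::field ^ 'v) set \<Rightarrow> ('f ^ 'v) set \<Rightarrow> nat" where
  "subspace_dist U W = vec.dim {x + y | x y. x \<in> U \<and> y \<in> W} - vec.dim (U \<inter> W)"

definition const_dim_code :: "nat \<Rightarrow> nat \<Rightarrow> ('f::{field,finite} ^ 'v) set set \<Rightarrow> bool" where
  "const_dim_code d k C \<longleftrightarrow>
     (\<forall>U\<in>C. vec.subspace U \<and> vec.dim U = k) \<and>
     (\<forall>U\<in>C. \<forall>W\<in>C. U \<noteq> W \<longrightarrow> d \<le> subspace_dist U W)"

definition A_code :: "'f::{field,finite} itself \<Rightarrow> 'v::finite itself \<Rightarrow> nat \<Rightarrow> nat \<Rightarrow> nat" where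
  "A_code _ _ d k = Max {card C | C :: ('f ^ 'v) set set. const_dim_code d k C}"

text \<open>Both maxima range over finite nonempty sets, so \<open>Max\<close> is a genuine maximum.\<close>

lemma Lambda_range_ok:
  "finite {card C | C :: ('f::{field,finite} ^ 'b::finite ^ 'a::finite) set. bounded_rank_code d u C}"
  "{card C | C :: ('f ^ 'b ^ 'a) set. bounded_rank_code d u C} \<noteq> {}"
proof -
  show "finite {card C | C :: ('f ^ 'b ^ 'a) set. bounded_rank_code d u C}"
    by simp
  have "bounded_rank_code d u ({} :: ('f ^ 'b ^ 'a) set)"
    by (simp add: bounded_rank_code_def)
  then show "{card C | C :: ('f ^ 'b ^ 'a) set. bounded_rank_code d u C} \<noteq> {}"
    by blast
qed

lemma A_code_range_ok:
  "finite {card C | C :: ('f::{field,finite} ^ 'v::finite) set set. const_dim_code d k C}"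
  "{card C | C :: ('f ^ 'v) set set. const_dim_code d k C} \<noteq> {}"
proof -
  show "finite {card C | C :: ('f ^ 'v) set set. const_dim_code d k C}"
    by simp
  have "const_dim_code d k ({} :: ('f ^ 'v) set set)"
    by (simp add: const_dim_code_def)
  then show "{card C | C :: ('f ^ 'v) set set. const_dim_code d k C} \<noteq> {}"
    by blast
qed

end

theory Submission imports Defs begin

text \<open>
  Match the codewords \<open>U\<close> of one subspace code with the codewords \<open>W\<close> of the other, and replace each
  pair by a matrix with column space \<open>U\<close> and row space \<open>W\<close>. For matrices \<open>A\<close> and \<open>B\<close> of rank \<open>u\<close>, the
  rank of \<open>A - B\<close> falls short of \<open>2 u\<close> by at most the dimension of the intersection of the column
  spaces plus that of the row spaces (an inequality of Marsaglia and Styan). Hence \<open>rk (A - B)\<close> is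
  at least half the sum of the two subspace distances.
\<close>

lemma (in finite_dimensional_vector_space_pair) dim_image_plus_dim_kernel:
  assumes f: "Vector_Spaces.linear s1 s2 f" and V: "vs1.subspace V"
  shows "vs2.dim (f ` V) + vs1.dim {x \<in> V. f x = 0} = vs1.dim V"
proof -
  interpret f: Vector_Spaces.linear s1 s2 f by (rule f)
  interpret reverse: finite_dimensional_vector_space_pair s2 B2 s1 B1 ..
  obtain g where g_V: "range g \<subseteq> V" and g: "Vector_Spaces.linear s2 s1 g"
    and fg: "\<And>y. y \<in> f ` V \<Longrightarrow> f (g y) = y"
    using linear_exists_right_inverse_on[OF f V] by blast
  interpret g: Vector_Spaces.linear s2 s1 g by (rule g)
  define K where "K = {x \<in> V. f x = 0}"
  define T where "T = g ` f ` V"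
  have image: "vs2.subspace (f ` V)"
    by (rule f.subspace_image[OF V])
  have "K = V \<inter> {x. f x = 0}"
    by (auto simp: K_def)
  then have K: "vs1.subspace K"
    by (simp add: vs1.subspace_inter V f.subspace_kernel)
  have T: "vs1.subspace T"
    unfolding T_def by (rule g.subspace_image[OF image])
  have "V = {x + y | x y. x \<in> K \<and> y \<in> T}"
  proof (intro equalityI subsetI)
    fix v assume v: "v \<in> V"
    then have "v - g (f v) \<in> K"
      using g_V fg V by (auto simp: K_def f.diff intro: vs1.subspace_diff)
    moreover have "g (f v) \<in> T"
      using v by (simp add: T_def)
    ultimately show "v \<in> {x + y | x y. x \<in> K \<and> y \<in> T}"
      using diff_add_cancel[of v "g (f v)", symmetric] by blast
  qed (use g_V V in \<open>auto simp: K_def T_def intro: vs1.subspace_add\<close>)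
  moreover have "K \<inter> T = {0}"
    using vs1.subspace_0[OF K] vs1.subspace_0[OF T] fg by (auto simp: K_def T_def g.zero)
  moreover have "vs1.dim T = vs2.dim (f ` V)"
    unfolding T_def using fg image
    by (intro reverse.dim_image_eq g inj_on_inverseI[where g = f])
      (simp add: vs2.span_eq_iff[THEN iffD2])
  ultimately show ?thesis
    using vs1.dim_sums_Int[OF K T] by (simp add: K_def)
qed

definition row_space :: "'f::field ^ 'n ^ 'm \<Rightarrow> ('f ^ 'n) set" where
  "row_space A = vec.span (rows A)"

definition col_space :: "'f::field ^ 'n ^ 'm \<Rightarrow> ('f ^ 'm) set" where
  "col_space A = vec.span (columns A)"

definition null_space :: "'f::field ^ 'n ^ 'm \<Rightarrow> ('f ^ 'n) set" where
  "null_space A = {x. A *v x = 0}"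

lemma subspace_row_space: "vec.subspace (row_space A)"
  by (simp add: row_space_def)

lemma subspace_col_space: "vec.subspace (col_space A)"
  by (simp add: col_space_def)

lemma row_space_transpose: "row_space (transpose A) = col_space A"
  by (simp add: row_space_def col_space_def)

lemma col_space_transpose: "col_space (transpose A) = row_space A"
  by (simp add: row_space_def col_space_def)

lemma col_space_eq_range:
  fixes A :: "'f::field ^ 'n ^ 'm"
  shows "col_space A = range ((*v) A)"
proof
  have "column j A = A *v axis j 1" for j
    by (simp add: vec_eq_iff column_def matrix_vector_mult_def axis_def if_distrib cong: if_cong)
  then have "columns A \<subseteq> range ((*v) A)"
    by (auto simp: columns_def)
  then show "col_space A \<subseteq> range ((*v) A)"
    unfolding col_space_def
    by (rule vec.span_minimal) (rule vec.subspace_image[OF vec.subspace_UNIV])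
  show "range ((*v) A) \<subseteq> col_space A"
    using matrix_vector_mult_in_columnspace_gen by (auto simp: col_space_def)
qed

lemma col_space_mult:
  fixes A :: "'f::field ^ 'n ^ 'm" and B :: "'f ^ 'k ^ 'n"
  shows "col_space (A ** B) = (*v) A ` col_space B"
  by (simp add: col_space_eq_range image_image matrix_vector_mul_assoc)

lemma rank_eq_dim_row_space: "rank A = vec.dim (row_space A)"
  by (simp add: row_rank_def_gen row_space_def)

lemma dim_rows_le_dim_columns_gen:
  fixes A :: "'f::field ^ 'n ^ 'm"
  shows "vec.dim (rows A) \<le> vec.dim (columns A)"
proof -
  obtain B where "vec.independent B" and span: "columns A \<subseteq> vec.span B"
    and card: "card B = vec.dim (columns A)"
    by (rule vec.basis_exists)
  then have B: "finite B"
    by (simp add: vec.finiteI_independent)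
  have "\<exists>c. column j A = (\<Sum>b\<in>B. c b *s b)" for j
    using span by (auto simp: columns_def vec.span_finite[OF B])
  then obtain c where c: "\<And>j. column j A = (\<Sum>b\<in>B. c j b *s b)"
    by metis
  define r where "r b = (\<chi> j. c j b)" for b
  have "row i A = (\<Sum>b\<in>B. b $ i *s r b)" for i
  proof -
    have "row i A $ j = (\<Sum>b\<in>B. b $ i *s r b) $ j" for j
      using arg_cong[OF c, of "\<lambda>v. v $ i" j]
      by (simp add: row_def column_def r_def mult.commute)
    then show ?thesis
      by (simp add: vec_eq_iff)
  qed
  then have "rows A \<subseteq> vec.span (r ` B)"
    by (auto simp: rows_def intro!: vec.span_sum vec.span_scale intro: vec.span_base)
  then have "vec.dim (rows A) \<le> card (r ` B)"
    using B by (simp add: vec.dim_le_card)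
  also have "\<dots> \<le> card B"
    using B by (rule card_image_le)
  finally show ?thesis
    by (simp only: card)
qed

lemma rank_transpose_gen:
  fixes A :: "'f::field ^ 'n ^ 'm"
  shows "rank (transpose A) = rank A"
  using dim_rows_le_dim_columns_gen[of A] dim_rows_le_dim_columns_gen[of "transpose A"]
  by (simp add: row_rank_def_gen)

lemma rank_eq_dim_col_space: "rank A = vec.dim (col_space A)"
  using rank_transpose_gen[of A] by (simp add: rank_eq_dim_row_space row_space_transpose)

lemma rank_plus_dim_null_space:
  fixes A :: "'f::field ^ 'n ^ 'm"
  shows "rank A + vec.dim (null_space A) = CARD('n)"
  using vec.dim_image_plus_dim_kernel[OF matrix_vector_mul_linear_gen[of A] vec.subspace_UNIV]
  by (simp add: rank_eq_dim_col_space col_space_eq_range null_space_def card_cart_basis)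

definition vstack :: "'f ^ 'n ^ 'm \<Rightarrow> 'f ^ 'n ^ 'k \<Rightarrow> 'f ^ 'n ^ ('m + 'k)" where
  "vstack A B = (\<chi> i. case i of Inl j \<Rightarrow> A $ j | Inr k \<Rightarrow> B $ k)"

lemma rows_vstack: "rows (vstack A B) = rows A \<union> rows B"
proof -
  have "row (Inl j) (vstack A B) = row j A" "row (Inr k) (vstack A B) = row k B" for j k
    by (simp_all add: row_def vstack_def)
  then show ?thesis
    by (simp add: rows_def set_eq_iff split_sum_ex)
qed

lemma null_space_vstack: "null_space (vstack A B) = null_space A \<inter> null_space B"
proof -
  have "(vstack A B *v x) $ Inl j = (A *v x) $ j" "(vstack A B *v x) $ Inr k = (B *v x) $ k" for x j k
    by (simp_all add: matrix_vector_mult_def vstack_def)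
  then show ?thesis
    by (auto simp: null_space_def vec_eq_iff split_sum_all)
qed

lemma rank_vstack:
  "rank (vstack A B) + vec.dim (row_space A \<inter> row_space B) = rank A + rank B"
proof -
  have "row_space (vstack A B) = {x + y | x y. x \<in> row_space A \<and> y \<in> row_space B}"
    by (simp add: row_space_def rows_vstack vec.span_Un)
  then show ?thesis
    using vec.dim_sums_Int[OF subspace_row_space[of A] subspace_row_space[of B]]
    by (simp add: rank_eq_dim_row_space)
qed

lemma rank_add_rank_le_rank_diff:
  fixes A B :: "'f::field ^ 'n ^ 'm"
  shows "rank A + rank B \<le> rank (A - B) + vec.dim (col_space A \<inter> col_space B)
    + vec.dim (row_space A \<inter> row_space B)"
proof -
  let ?H = "null_space (A - B)"
  have "(*v) A ` ?H = (*v) B ` ?H"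
    by (intro image_cong) (simp_all add: null_space_def matrix_vector_mult_diff_rdistrib)
  then have "(*v) A ` ?H \<subseteq> col_space A \<inter> col_space B"
    by (metis Int_greatest col_space_eq_range image_mono subset_UNIV)
  then have image: "vec.dim ((*v) A ` ?H) \<le> vec.dim (col_space A \<inter> col_space B)"
    by (rule vec.dim_subset)
  have kernel: "{x \<in> ?H. A *v x = 0} = null_space (vstack A B)"
    unfolding null_space_vstack
    by (auto simp: null_space_def matrix_vector_mult_diff_rdistrib)
  have "vec.subspace ?H"
    unfolding null_space_def by (rule vec.subspace_kernel)
  from vec.dim_image_plus_dim_kernel[OF matrix_vector_mul_linear_gen this, of A]
  have "vec.dim ((*v) A ` ?H) + vec.dim (null_space (vstack A B)) = vec.dim ?H"
    by (simp only: kernel)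
  with image have "rank (vstack A B) \<le> rank (A - B) + vec.dim (col_space A \<inter> col_space B)"
    using rank_plus_dim_null_space[of "A - B"] rank_plus_dim_null_space[of "vstack A B"]
    by linarith
  then show ?thesis
    using rank_vstack[of A B] by linarith
qed

lemma exists_matrix_col_space:
  fixes U :: "('f::field ^ 'm) set"
  assumes "vec.subspace U"
  shows "\<exists>P :: 'f ^ 'm ^ 'm. col_space P = U"
proof -
  obtain B where B: "vec.independent B" and span: "vec.span B = U"
    using vec.basis_exists[of U] assms by (metis vec.span_subspace)
  obtain g :: "'f ^ 'm \<Rightarrow> 'f ^ 'm" where g: "Vector_Spaces.linear (*s) (*s) g" "range g = U"
    using vec.linear_independent_extend_subspace[OF B, of id] span by auto
  then have "col_space (matrix g) = U"
    by (simp add: col_space_eq_range matrix_works)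
  then show ?thesis ..
qed

lemma exists_matrix_col_space_row_space:
  fixes U :: "('f::field ^ 'm) set" and W :: "('f ^ 'n) set"
  assumes U: "vec.subspace U" and W: "vec.subspace W" and dim: "vec.dim U = vec.dim W"
  shows "\<exists>X :: 'f ^ 'n ^ 'm. col_space X = U \<and> row_space X = W"
proof -
  obtain P :: "'f ^ 'm ^ 'm" where P: "col_space P = U"
    using exists_matrix_col_space[OF U] by blast
  have "vec.dim (row_space P) = vec.dim W"
    using P dim by (metis rank_eq_dim_row_space rank_eq_dim_col_space)
  then obtain h where h: "Vector_Spaces.linear (*s) (*s) h" "h ` row_space P = W"
    using vec.subspace_isomorphism[OF subspace_row_space W] by blast
  define X where "X = P ** transpose (matrix h)"
  have "row_space X = col_space (matrix h ** transpose P)"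
    by (simp add: X_def matrix_transpose_mul flip: col_space_transpose)
  also have "\<dots> = h ` row_space P"
    using h(1) by (simp add: col_space_mult col_space_transpose matrix_works)
  finally have row: "row_space X = W"
    using h(2) by simp
  have "col_space X \<subseteq> col_space P"
    by (auto simp: X_def col_space_mult col_space_eq_range[of P])
  moreover have "vec.dim (col_space X) = vec.dim U"
    using row dim by (metis rank_eq_dim_row_space rank_eq_dim_col_space)
  ultimately have "col_space X = U"
    unfolding P by (intro vec.subspace_dim_equal subspace_col_space U) simp_all
  with row show ?thesis
    by blast
qed

lemma subspace_dist_plus_dim_Int:
  assumes "vec.subspace U" "vec.subspace W"
  shows "subspace_dist U W + 2 * vec.dim (U \<inter> W) = vec.dim U + vec.dim W"
proof -
  have "vec.dim (U \<inter> W) \<le> vec.dim U" "vec.dim (U \<inter> W) \<le> vec.dim W"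
    by (simp_all add: vec.dim_subset)
  then show ?thesis
    using vec.dim_sums_Int[OF assms] unfolding subspace_dist_def by linarith
qed

lemma subspace_dist_le_rank_diff:
  fixes X Y :: "'f::field ^ 'n ^ 'm"
  shows "subspace_dist (col_space X) (col_space Y) + subspace_dist (row_space X) (row_space Y)
    \<le> 2 * rank (X - Y)"
  using rank_add_rank_le_rank_diff[of X Y]
    subspace_dist_plus_dim_Int[OF subspace_col_space[of X] subspace_col_space[of Y]]
    subspace_dist_plus_dim_Int[OF subspace_row_space[of X] subspace_row_space[of Y]]
  unfolding rank_eq_dim_row_space[symmetric] rank_eq_dim_col_space[symmetric] by linarith

lemma exists_const_dim_code:
  assumes "n \<le> A_code TYPE('f::{field,finite}) TYPE('v::finite) d k"
  shows "\<exists>C :: ('f ^ 'v) set set. const_dim_code d k C \<and> card C = n"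
proof -
  obtain C :: "('f ^ 'v) set set" where C: "const_dim_code d k C"
    and card: "card C = A_code TYPE('f) TYPE('v) d k"
    using Max_in[OF A_code_range_ok[where 'f='f and 'v='v and d=d and k=k]]
    unfolding A_code_def by auto
  obtain D where D: "D \<subseteq> C" "card D = n"
    using assms card obtain_subset_with_card_n by metis
  then have "const_dim_code d k D"
    using C unfolding const_dim_code_def by blast
  with D show ?thesis
    by blast
qed

lemma card_le_Lambda:
  fixes C :: "('f::{field,finite} ^ 'b::finite ^ 'a::finite) set"
  assumes "bounded_rank_code d u C"
  shows "card C \<le> Lambda TYPE('f) TYPE('a) TYPE('b) d u"
  unfolding Lambda_def using assms by (intro Max_ge Lambda_range_ok) auto

lemma exists_bounded_rank_code:
  fixes C :: "('f::{field,finite} ^ 'a::finite) set set" and D :: "('f ^ 'b::finite) set set"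
  assumes C: "const_dim_code d\<^sub>1 u C" and D: "const_dim_code d\<^sub>2 u D" and card: "card C = card D"
    and d: "2 * d \<le> d\<^sub>1 + d\<^sub>2"
  shows "\<exists>M :: ('f ^ 'b ^ 'a) set. bounded_rank_code d u M \<and> card M = card C"
proof -
  obtain p where p: "bij_betw p C D"
    using finite_same_card_bij[of C D] card by auto
  have "\<exists>X :: 'f ^ 'b ^ 'a. col_space X = U \<and> row_space X = p U" if "U \<in> C" for U
    using that C D bij_betwE[OF p]
    by (intro exists_matrix_col_space_row_space) (auto simp: const_dim_code_def)
  then obtain X :: "('f ^ 'a) set \<Rightarrow> 'f ^ 'b ^ 'a"
    where X: "\<And>U. U \<in> C \<Longrightarrow> col_space (X U) = U" "\<And>U. U \<in> C \<Longrightarrow> row_space (X U) = p U"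
    by metis
  have "d \<le> rank (X U - X V)" if UV: "U \<in> C" "V \<in> C" "U \<noteq> V" for U V
  proof -
    have "p U \<in> D" "p V \<in> D" "p U \<noteq> p V"
      using UV p by (auto simp: bij_betw_def inj_on_def)
    then have "d\<^sub>1 \<le> subspace_dist U V" "d\<^sub>2 \<le> subspace_dist (p U) (p V)"
      using C D UV by (auto simp: const_dim_code_def)
    then show ?thesis
      using subspace_dist_le_rank_diff[of "X U" "X V"] UV d by (simp add: X)
  qed
  moreover have "rank (X U) = u" if "U \<in> C" for U
    using that C by (simp add: rank_eq_dim_col_space X const_dim_code_def)
  ultimately have "bounded_rank_code d u (X ` C)"
    by (auto simp: bounded_rank_code_def)
  moreover have "inj_on X C"
    by (rule inj_on_inverseI[where g = col_space]) (rule X)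
  ultimately show ?thesis
    using card_image by blast
qed

theorem theorem15:
  fixes d d\<^sub>1 d\<^sub>2 u :: nat
  assumes "d > 0" and "d\<^sub>1 > 0" and "d\<^sub>2 > 0" and "u > 0"
    and "2 * d \<le> d\<^sub>1 + d\<^sub>2"
  shows "Lambda TYPE('f::{field,finite}) TYPE('a::finite) TYPE('b::finite) d u
    \<ge> min (A_code TYPE('f) TYPE('a) d\<^sub>1 u) (A_code TYPE('f) TYPE('b) d\<^sub>2 u)"
    (is "_ \<ge> ?m")
proof -
  obtain C :: "('f ^ 'a) set set" where C: "const_dim_code d\<^sub>1 u C" "card C = ?m"
    using exists_const_dim_code[OF min.cobounded1] by blast
  obtain D :: "('f ^ 'b) set set" where D: "const_dim_code d\<^sub>2 u D" "card D = ?m"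
    using exists_const_dim_code[OF min.cobounded2] by blast
  obtain M :: "('f ^ 'b ^ 'a) set" where "bounded_rank_code d u M" "card M = ?m"
    using exists_bounded_rank_code[OF C(1) D(1) _ assms(5)] C(2) D(2) by metis
  then show ?thesis
    using card_le_Lambda by metis
qed

end
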